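(* Let $X$ be a Hausdorff Baire space and $Y$ a Banach space. Then the map $\varphi$ from $(MU(X,Y),\tau_U)$ onto $(MC(X,Y),\tau_U)$, defined by $\varphi(F)(x)=\overline{co}\,F(x)$ for all $x\in X$, is a homeomorphism.
   Context: A set-valued map $F$ from $X$ to $Y$ assigns to each $x\in X$ a subset $F(x)\subset Y$. Write $G\subset F$ if $G(x)\subset F(x)$ for all $x\in X$. $F$ is upper semicontinuous if for every $x\in X$ and every open $V\supset F(x)$ there is an open neighborhood $U$ of $x$ with $F(u)\subset V$ for all $u\in U$. $F$ is usco if it is upper semicontinuous and all its values are nonempty and compact; $F$ is cusco if it is usco and all its values are convex. $F$ is minimal usco (minimal cusco) if it is usco (cusco) and does not properly contain any other usco (cusco) map from $X$ to $Y$. $MU(X,Y)$ and $MC(X,Y)$ denote the sets of all minimal usco and all minimal cusco maps from $X$ to $Y$, respectively. $\overline{co}\,B$ denotes the closed convex hull of $B$. $Y$ carries the metric $d$ induced by its norm. For nonempty closed $A,B\subset Y$, let $e_d(A,B)=\sup\{d(a,B):a\in A\}$, where $d(a,B)=\inf_{b\in B}d(a,b)$, and let $H_d(A,B)=\max\{e_d(A,B),e_d(B,A)\}$ (the extended-valued Hausdorff metric). Let $F(X,Y)$ be the set of all set-valued maps from $X$ to $Y$ with nonempty closed values. The topology $\tau_U$ of uniform convergence on $F(X,Y)$ is generated by the extended-valued metric $\varrho(\Phi,\Psi)=\sup\{H_d(\Phi(x),\Psi(x)):x\in X\}$. $MU(X,Y)$ and $MC(X,Y)$ carry the corresponding subspace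 topologies. *)

theory Defs
  imports "HOL-Analysis.Analysis"
begin

text \<open>The intersection with the carrier only matters for the empty family, where
  \<open>\<Inter>{} = UNIV\<close>.\<close>

definition Baire_space :: "'a topology \<Rightarrow> bool" where
  "Baire_space X \<longleftrightarrow>
     (\<forall>\<G>. countable \<G> \<and> (\<forall>G\<in>\<G>. openin X G \<and> X closure_of G = topspace X)
        \<longrightarrow> X closure_of (topspace X \<inter> \<Inter>\<G>) = topspace X)"

text \<open>A set-valued map from \<open>X\<close> to the type \<open>'b\<close> is a function \<open>'a \<Rightarrow> 'b set\<close> whose values
  matter only on \<open>topspace X\<close>. So that equality of functions is equality of maps, the maps are
  normalised to be \<^const>\<open>extensional\<close> on \<open>topspace X\<close>.\<close>

definition submap :: "'a topology \<Rightarrow> ('a \<Rightarrow> 'b set) \<Rightarrow> ('a \<Rightarrow> 'b set) \<Rightarrow> bool" where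
  "submap X G F \<longleftrightarrow> (\<forall>x\<in>topspace X. G x \<subseteq> F x)"

definition upper_semicontinuous ::
    "'a topology \<Rightarrow> ('a \<Rightarrow> 'b::topological_space set) \<Rightarrow> bool" where
  "upper_semicontinuous X F \<longleftrightarrow>
     (\<forall>x\<in>topspace X. \<forall>V. open V \<and> F x \<subseteq> V
        \<longrightarrow> (\<exists>U. openin X U \<and> x \<in> U \<and> (\<forall>u\<in>U. F u \<subseteq> V)))"

definition usco :: "'a topology \<Rightarrow> ('a \<Rightarrow> 'b::topological_space set) \<Rightarrow> bool" where
  "usco X F \<longleftrightarrow>
     F \<in> extensional (topspace X) \<and> upper_semicontinuous X F \<and>
     (\<forall>x\<in>topspace X. F x \<noteq> {} \<and> compact (F x))"

definition cusco :: "'a topology \<Rightarrow> ('a \<Rightarrow> 'b::real_normed_vector set) \<Rightarrow> bool" where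
  "cusco X F \<longleftrightarrow> usco X F \<and> (\<forall>x\<in>topspace X. convex (F x))"

definition minimal_usco :: "'a topology \<Rightarrow> ('a \<Rightarrow> 'b::topological_space set) \<Rightarrow> bool" where
  "minimal_usco X F \<longleftrightarrow> usco X F \<and> (\<forall>G. usco X G \<and> submap X G F \<longrightarrow> G = F)"

definition minimal_cusco :: "'a topology \<Rightarrow> ('a \<Rightarrow> 'b::real_normed_vector set) \<Rightarrow> bool" where
  "minimal_cusco X F \<longleftrightarrow> cusco X F \<and> (\<forall>G. cusco X G \<and> submap X G F \<longrightarrow> G = F)"

definition MU :: "'a topology \<Rightarrow> ('a \<Rightarrow> 'b::topological_space set) set" where
  "MU X = {F. minimal_usco X F}"

definition MC :: "'a topology \<Rightarrow> ('a \<Rightarrow> 'b::real_normed_vector set) set" where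
  "MC X = {F. minimal_cusco X F}"

text \<open>Only used for nonempty closed sets; there \<^const>\<open>infdist\<close> is the infimum of the
  distances (on the empty set the library makes it \<open>0\<close>).\<close>

definition excess :: "'b::metric_space set \<Rightarrow> 'b set \<Rightarrow> ennreal" where
  "excess A B = (SUP a\<in>A. ennreal (infdist a B))"

definition Hausdorff_edist :: "'b::metric_space set \<Rightarrow> 'b set \<Rightarrow> ennreal" where
  "Hausdorff_edist A B = max (excess A B) (excess B A)"

definition closed_valued_maps :: "'a topology \<Rightarrow> ('a \<Rightarrow> 'b::metric_space set) set" where
  "closed_valued_maps X = (topspace X \<rightarrow>\<^sub>E {B. B \<noteq> {} \<and> closed B})"

definition uniform_edist ::
    "'a topology \<Rightarrow> ('a \<Rightarrow> 'b::metric_space set) \<Rightarrow> ('a \<Rightarrow> 'b set) \<Rightarrow> ennreal" where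
  "uniform_edist X \<Phi> \<Psi> = (SUP x\<in>topspace X. Hausdorff_edist (\<Phi> x) (\<Psi> x))"

text \<open>The library's metric topologies need real-valued metrics, so the topology of the
  extended-valued metric is spelled out.\<close>

definition uniform_convergence_topology ::
    "'a topology \<Rightarrow> ('a \<Rightarrow> 'b::metric_space set) topology" where
  "uniform_convergence_topology X =
     topology (\<lambda>\<U>. \<U> \<subseteq> closed_valued_maps X \<and>
       (\<forall>\<Phi>\<in>\<U>. \<exists>\<epsilon>>0. {\<Psi> \<in> closed_valued_maps X. uniform_edist X \<Phi> \<Psi> < ennreal \<epsilon>} \<subseteq> \<U>))"

lemma openin_uniform_convergence_topology:
  fixes X :: "'a topology" and \<U> :: "('a \<Rightarrow> 'b::metric_space set) set"
  shows "openin (uniform_convergence_topology X) \<U> \<longleftrightarrow>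
     \<U> \<subseteq> closed_valued_maps X \<and>
     (\<forall>\<Phi>\<in>\<U>. \<exists>\<epsilon>>0. {\<Psi> \<in> closed_valued_maps X. uniform_edist X \<Phi> \<Psi> < ennreal \<epsilon>} \<subseteq> \<U>)"
proof -
  let ?B = "\<lambda>(\<Phi> :: 'a \<Rightarrow> 'b set) \<epsilon>. {\<Psi> \<in> closed_valued_maps X. uniform_edist X \<Phi> \<Psi> < ennreal \<epsilon>}"
  have "istopology (\<lambda>\<U>. \<U> \<subseteq> closed_valued_maps X \<and> (\<forall>\<Phi>\<in>\<U>. \<exists>\<epsilon>>0. ?B \<Phi> \<epsilon> \<subseteq> \<U>))"
    unfolding istopology_def
  proof (intro conjI allI impI ballI)
    fix S T :: "('a \<Rightarrow> 'b set) set" and \<Phi>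
    assume S: "S \<subseteq> closed_valued_maps X \<and> (\<forall>\<Phi>\<in>S. \<exists>\<epsilon>>0. ?B \<Phi> \<epsilon> \<subseteq> S)"
      and T: "T \<subseteq> closed_valued_maps X \<and> (\<forall>\<Phi>\<in>T. \<exists>\<epsilon>>0. ?B \<Phi> \<epsilon> \<subseteq> T)"
    show "S \<inter> T \<subseteq> closed_valued_maps X" using S by blast
    assume "\<Phi> \<in> S \<inter> T"
    then obtain d e where de: "d > 0" "?B \<Phi> d \<subseteq> S" "e > 0" "?B \<Phi> e \<subseteq> T"
      using S[THEN conjunct2, rule_format, of \<Phi>] T[THEN conjunct2, rule_format, of \<Phi>] by auto
    have "ennreal (min d e) \<le> ennreal d" "ennreal (min d e) \<le> ennreal e"
      by (auto intro: ennreal_leI)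
    then have "?B \<Phi> (min d e) \<subseteq> ?B \<Phi> d \<inter> ?B \<Phi> e"
      by (auto intro: order_less_le_trans)
    also have "\<dots> \<subseteq> S \<inter> T" using de by (intro Int_mono)
    finally show "\<exists>\<epsilon>>0. ?B \<Phi> \<epsilon> \<subseteq> S \<inter> T" using de by (intro exI[of _ "min d e"]) simp
  next
    fix K :: "('a \<Rightarrow> 'b set) set set"
    assume K: "\<forall>S\<in>K. S \<subseteq> closed_valued_maps X \<and> (\<forall>\<Phi>\<in>S. \<exists>\<epsilon>>0. ?B \<Phi> \<epsilon> \<subseteq> S)"
    then show "\<Union>K \<subseteq> closed_valued_maps X" by (simp add: Union_least)
    fix \<Phi> assume "\<Phi> \<in> \<Union>K"
    then obtain S where S: "S \<in> K" "\<Phi> \<in> S" by blast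
    then obtain e where e: "e > 0" "?B \<Phi> e \<subseteq> S"
      using K[rule_format, OF S(1), THEN conjunct2, rule_format, OF S(2)] by auto
    have "?B \<Phi> e \<subseteq> \<Union>K" using e(2) Union_upper[OF S(1)] by (rule order_trans)
    then show "\<exists>\<epsilon>>0. ?B \<Phi> \<epsilon> \<subseteq> \<Union>K" using e(1) by (intro exI[of _ e] conjI)
  qed
  then show ?thesis
    unfolding uniform_convergence_topology_def by (subst topology_inverse') auto
qed

lemma topspace_uniform_convergence_topology [simp]:
  "topspace (uniform_convergence_topology X) = closed_valued_maps X"
proof -
  have "openin (uniform_convergence_topology X) (closed_valued_maps X)"
    unfolding openin_uniform_convergence_topology by (auto intro: exI[of _ 1])
  then show ?thesis
    by (metis openin_subset openin_topspace openin_uniform_convergence_topology subset_antisym)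
qed

definition MU_topology :: "'a topology \<Rightarrow> ('a \<Rightarrow> 'b::metric_space set) topology" where
  "MU_topology X = subtopology (uniform_convergence_topology X) (MU X)"

definition MC_topology :: "'a topology \<Rightarrow> ('a \<Rightarrow> 'b::real_normed_vector set) topology" where
  "MC_topology X = subtopology (uniform_convergence_topology X) (MC X)"

lemma usco_in_closed_valued_maps: "usco X F \<Longrightarrow> F \<in> closed_valued_maps X"
  by (auto simp: usco_def closed_valued_maps_def PiE_def compact_imp_closed)

lemma topspace_MU_topology [simp]: "topspace (MU_topology X) = MU X"
  by (auto simp: MU_topology_def MU_def minimal_usco_def intro: usco_in_closed_valued_maps)

lemma topspace_MC_topology [simp]: "topspace (MC_topology X) = MC X"
  by (auto simp: MC_topology_def MC_def minimal_cusco_def cusco_def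
      intro: usco_in_closed_valued_maps)

definition closed_convex_hull_map ::
    "'a topology \<Rightarrow> ('a \<Rightarrow> 'b::real_normed_vector set) \<Rightarrow> ('a \<Rightarrow> 'b set)" where
  "closed_convex_hull_map X F = (\<lambda>x\<in>topspace X. closure (convex hull (F x)))"

end

(*
  A minimal usco map F from a Baire space into a metric space is single-valued on a dense set D,
  and it is the closure of its restriction to D: whenever F x meets an open set V, every
  neighbourhood of x contains a nonempty open set on which the values of F lie in V.  Hence an
  estimate between F and another usco map that holds on D holds everywhere.  At points of D the
  closed convex hull does not change F, so the hull of F is a minimal cusco map, and the hull map
  preserves uniform distances: it cannot increase them because closed neighbourhoods of compact
  convex sets are closed and convex, and it cannot decrease them by the density argument.  It is
  onto since, by Zorn's lemma, every minimal cusco map contains a minimal usco map, whose hull it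
  must be.
*)

theory Submission
  imports Defs
begin

section \<open>Compact sets and their convex hulls\<close>

text \<open>Compactness makes the infimum a minimum, so the closed \<open>r\<close>-neighbourhood of
  \<open>B\<close> is exactly a union of closed balls.\<close>

lemma infdist_le_iff_compact:
  fixes B :: "'b::metric_space set"
  assumes "compact B" "B \<noteq> {}"
  shows "infdist y B \<le> r \<longleftrightarrow> y \<in> (\<Union>x\<in>B. cball x r)"
proof
  assume L: "infdist y B \<le> r"
  have "continuous_on B (dist y)" by (intro continuous_intros)
  then obtain x where x: "x \<in> B" "\<forall>z\<in>B. dist y x \<le> dist y z"
    using continuous_attains_inf[OF assms] by blast
  have "dist y x \<le> infdist y B"
    using assms(2) x(2) by (auto simp: infdist_notempty intro!: cINF_greatest)
  with L x(1) show "y \<in> (\<Union>x\<in>B. cball x r)"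
    by (auto simp: dist_commute intro!: bexI[of _ x])
next
  assume "y \<in> (\<Union>x\<in>B. cball x r)"
  then show "infdist y B \<le> r" by (auto simp: dist_commute intro: infdist_le2)
qed

text \<open>The neighbourhood is the Minkowski sum of \<open>B\<close> and \<open>cball 0 r\<close>.
  In this form it is closed for compact \<open>B\<close> and convex for convex
  \<open>B\<close>.\<close>

lemma UN_cball_eq_sums:
  fixes B :: "'b::real_normed_vector set"
  shows "(\<Union>x\<in>B. cball x r) = (\<Union>x\<in>B. \<Union>y\<in>cball 0 r. {x + y})"
proof -
  have "cball x r = (\<Union>y\<in>cball 0 r. {x + y})" for x :: 'b
  proof -
    have "cball x r = (+) x ` cball 0 r" using cball_translation[of x 0 r] by simp
    then show ?thesis by blast
  qed
  then show ?thesis by (rule SUP_cong[OF refl])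
qed

lemma closed_UN_cball:
  fixes B :: "'b::real_normed_vector set"
  assumes "compact B" shows "closed (\<Union>x\<in>B. cball x r)"
  unfolding UN_cball_eq_sums by (rule compact_closed_sums[OF assms closed_cball])

lemma convex_UN_cball:
  fixes B :: "'b::real_normed_vector set"
  assumes "convex B" shows "convex (\<Union>x\<in>B. cball x r)"
  unfolding UN_cball_eq_sums by (rule convex_sums[OF assms convex_cball])

lemma closure_convex_hull_minimal:
  fixes A :: "'b::real_normed_vector set"
  assumes "A \<subseteq> K" "closed K" "convex K" shows "closure (convex hull A) \<subseteq> K"
  using assms by (intro closure_minimal hull_minimal)

lemma subset_closure_convex_hull: "A \<subseteq> closure (convex hull A)"
  by (rule order_trans[OF hull_subset closure_subset])

text \<open>Mazur's theorem. Completeness is inherited from the Banach space. For total boundedness,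
  a finite \<open>e/3\<close>-net of \<open>S\<close> has a compact hull, the hull of
  \<open>S\<close> stays within \<open>e/3\<close> of it, and a finite \<open>e/3\<close>-net of
  that compact hull is an \<open>e\<close>-net of the whole.\<close>

theorem compact_closure_convex_hull:
  fixes S :: "'b::banach set"
  assumes "compact S" shows "compact (closure (convex hull S))"
  unfolding compact_eq_totally_bounded
proof (intro conjI allI impI)
  show "complete (closure (convex hull S))"
    by (simp add: complete_eq_closed)
  fix e :: real assume e: "e > 0"
  have cover: "\<exists>k. finite k \<and> T \<subseteq> (\<Union>x\<in>k. ball x (e/3))" if "compact T" for T :: "'b set"
    using compact_eq_totally_bounded[THEN iffD1, OF that] e by simp
  from cover[OF assms] obtain k where k: "finite k" "S \<subseteq> (\<Union>x\<in>k. ball x (e/3))"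
    by blast
  let ?K = "convex hull k"
  have K: "compact ?K" using k(1) by (rule finite_imp_compact_convex_hull)
  have "S \<subseteq> (\<Union>x\<in>?K. cball x (e/3))"
    by (rule order_trans[OF k(2) UN_mono[OF hull_subset ball_subset_cball]])
  \<comment> \<open>The neighbourhood of \<open>?K\<close> is closed and convex, so with
    \<open>S\<close> it absorbs the closed convex hull of \<open>S\<close>.\<close>
  then have sub: "closure (convex hull S) \<subseteq> (\<Union>x\<in>?K. cball x (e/3))"
    by (rule closure_convex_hull_minimal[OF _ closed_UN_cball[OF K]
          convex_UN_cball[OF convex_convex_hull]])
  from cover[OF K] obtain k' where k': "finite k'" "?K \<subseteq> (\<Union>x\<in>k'. ball x (e/3))"
    by (elim exE conjE)
  have "closure (convex hull S) \<subseteq> (\<Union>x\<in>k'. ball x e)"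
  proof
    fix y assume "y \<in> closure (convex hull S)"
    then obtain x where x: "x \<in> ?K" "dist x y \<le> e/3" using sub by auto
    then obtain z where z: "z \<in> k'" "dist z x < e/3" using k'(2) by auto
    have "dist z y < e" using dist_triangle[of z y x] x z e by linarith
    with z show "y \<in> (\<Union>x\<in>k'. ball x e)" by auto
  qed
  with k'(1) show "\<exists>k. finite k \<and> closure (convex hull S) \<subseteq> (\<Union>x\<in>k. ball x e)" by blast
qed

section \<open>Excess and uniform distance\<close>

text \<open>Replaces suprema of distances by an inclusion, to which hull minimality applies. The
  sign of \<open>r\<close> matters because \<open>ennreal\<close> sends negative numbers to
  0.\<close>

lemma excess_le_iff:
  fixes B :: "'b::metric_space set"
  assumes "compact B" "B \<noteq> {}" "r \<ge> 0"
  shows "excess A B \<le> ennreal r \<longleftrightarrow> A \<subseteq> (\<Union>x\<in>B. cball x r)"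
  using infdist_le_iff_compact[OF assms(1,2)] assms(3)
  by (auto simp: excess_def SUP_le_iff ennreal_le_iff subset_iff)

text \<open>The middle set must be nonempty: \<open>infdist\<close> to the empty set is 0, so both
  summands would vanish.\<close>

lemma excess_triangle:
  fixes A B C :: "'b::metric_space set"
  assumes "B \<noteq> {}"
  shows "excess A C \<le> excess A B + excess B C"
proof (cases "excess B C")
  case (real e)
  have BC: "infdist b C \<le> e" if "b \<in> B" for b
  proof -
    have "ennreal (infdist b C) \<le> ennreal e"
      unfolding real(2)[symmetric] excess_def by (rule SUP_upper[OF that])
    then show ?thesis using real(1) by (simp add: ennreal_le_iff)
  qed
  have "ennreal (infdist a C) \<le> excess A B + excess B C" if a: "a \<in> A" for a
  proof -
    \<comment> \<open>With \<open>e\<close> moved to the left, the bound can be checked against each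
      \<open>b\<close> separately and passes to the infimum.\<close>
    have "infdist a C - e \<le> infdist a B"
      unfolding infdist_notempty[OF assms, of a]
    proof (rule cINF_greatest[OF assms])
      fix b assume "b \<in> B"
      then show "infdist a C - e \<le> dist a b"
        using infdist_triangle[of a C b] BC[of b] by linarith
    qed
    then have "ennreal (infdist a C) \<le> ennreal (infdist a B + e)" by (intro ennreal_leI) simp
    also have "\<dots> = ennreal (infdist a B) + excess B C"
      using real by (simp add: infdist_nonneg)
    also have "\<dots> \<le> excess A B + excess B C"
      unfolding excess_def[of A B] by (intro add_right_mono SUP_upper a)
    finally show ?thesis .
  qed
  then show ?thesis unfolding excess_def[of A C] by (rule SUP_least)
qed simp

lemma Hausdorff_edist_triangle:
  assumes "B \<noteq> {}"
  shows "Hausdorff_edist A C \<le> Hausdorff_edist A B + Hausdorff_edist B C"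
proof -
  have "excess A C \<le> Hausdorff_edist A B + Hausdorff_edist B C"
    by (rule order_trans[OF excess_triangle[OF assms] add_mono]) (auto simp: Hausdorff_edist_def)
  moreover have "excess C A \<le> Hausdorff_edist B C + Hausdorff_edist A B"
    by (rule order_trans[OF excess_triangle[OF assms] add_mono]) (auto simp: Hausdorff_edist_def)
  ultimately show ?thesis
    unfolding Hausdorff_edist_def[of A C] by (simp add: add.commute)
qed

lemma uniform_edist_triangle:
  assumes "\<Psi> \<in> closed_valued_maps X"
  shows "uniform_edist X \<Phi> \<Theta> \<le> uniform_edist X \<Phi> \<Psi> + uniform_edist X \<Psi> \<Theta>"
  unfolding uniform_edist_def[of X \<Phi> \<Theta>]
proof (rule SUP_least)
  fix x assume x: "x \<in> topspace X"
  with assms have "\<Psi> x \<noteq> {}" by (auto simp: closed_valued_maps_def)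
  then have "Hausdorff_edist (\<Phi> x) (\<Theta> x)
      \<le> Hausdorff_edist (\<Phi> x) (\<Psi> x) + Hausdorff_edist (\<Psi> x) (\<Theta> x)"
    by (rule Hausdorff_edist_triangle)
  also have "\<dots> \<le> uniform_edist X \<Phi> \<Psi> + uniform_edist X \<Psi> \<Theta>"
    unfolding uniform_edist_def by (intro add_mono SUP_upper x)
  finally show "Hausdorff_edist (\<Phi> x) (\<Theta> x) \<le> uniform_edist X \<Phi> \<Psi> + uniform_edist X \<Psi> \<Theta>" .
qed

lemma uniform_edist_self: "uniform_edist X \<Phi> \<Phi> = 0"
proof -
  have "excess A A \<le> 0" for A :: "'b set"
    unfolding excess_def by (rule SUP_least) simp
  then have "Hausdorff_edist A A = 0" for A :: "'b set"
    by (simp add: Hausdorff_edist_def)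
  then have "uniform_edist X \<Phi> \<Phi> \<le> 0"
    unfolding uniform_edist_def by (intro SUP_least) simp
  then show ?thesis by simp
qed

section \<open>The uniform topology on subspaces, and isometries\<close>

text \<open>By the triangle inequality, a point at distance \<open>d\<close> from the centre keeps a
  ball of radius \<open>\<epsilon> - d\<close> inside.\<close>

lemma openin_uniform_edist_ball:
  assumes "\<Phi> \<in> closed_valued_maps X"
  shows "openin (uniform_convergence_topology X)
           {\<Psi> \<in> closed_valued_maps X. uniform_edist X \<Phi> \<Psi> < ennreal \<epsilon>}"
  unfolding openin_uniform_convergence_topology
proof (intro conjI ballI)
  fix \<Psi> assume "\<Psi> \<in> {\<Psi> \<in> closed_valued_maps X. uniform_edist X \<Phi> \<Psi> < ennreal \<epsilon>}"
  then have \<Psi>: "\<Psi> \<in> closed_valued_maps X" and lt: "uniform_edist X \<Phi> \<Psi> < ennreal \<epsilon>" by auto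
  then obtain d where d: "d \<ge> 0" "uniform_edist X \<Phi> \<Psi> = ennreal d"
    by (cases "uniform_edist X \<Phi> \<Psi>") auto
  with lt have de: "d < \<epsilon>" by (simp add: ennreal_less_iff)
  have "uniform_edist X \<Phi> \<Theta> < ennreal \<epsilon>" if "uniform_edist X \<Psi> \<Theta> < ennreal (\<epsilon> - d)" for \<Theta>
  proof -
    have "uniform_edist X \<Phi> \<Theta> \<le> ennreal d + uniform_edist X \<Psi> \<Theta>"
      using uniform_edist_triangle[OF \<Psi>, of \<Phi> \<Theta>] d by simp
    also have "\<dots> < ennreal d + ennreal (\<epsilon> - d)"
      using that by (simp add: ennreal_add_left_cancel_less)
    also have "\<dots> = ennreal \<epsilon>" using d de by (simp flip: ennreal_plus)
    finally show ?thesis .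
  qed
  with de show "\<exists>\<epsilon>'>0. {\<Theta> \<in> closed_valued_maps X. uniform_edist X \<Psi> \<Theta> < ennreal \<epsilon>'}
      \<subseteq> {\<Psi> \<in> closed_valued_maps X. uniform_edist X \<Phi> \<Psi> < ennreal \<epsilon>}"
    by (intro exI[of _ "\<epsilon> - d"]) auto
qed auto

text \<open>The subspace topology is again described by balls, now taken within \<open>M\<close>, so
  later arguments need not leave \<open>M\<close>.\<close>

lemma openin_subtopology_uniform_convergence:
  assumes M: "M \<subseteq> closed_valued_maps X"
  shows "openin (subtopology (uniform_convergence_topology X) M) S \<longleftrightarrow>
    S \<subseteq> M \<and> (\<forall>\<Phi>\<in>S. \<exists>\<epsilon>>0. {\<Psi> \<in> M. uniform_edist X \<Phi> \<Psi> < ennreal \<epsilon>} \<subseteq> S)"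
    (is "?L \<longleftrightarrow> ?R")
proof
  assume ?L
  then obtain T where T: "openin (uniform_convergence_topology X) T" "S = T \<inter> M"
    by (auto simp: openin_subtopology)
  show ?R
  proof (intro conjI ballI)
    fix \<Phi> assume "\<Phi> \<in> S"
    then obtain e where "e > 0" "{\<Psi> \<in> closed_valued_maps X. uniform_edist X \<Phi> \<Psi> < ennreal e} \<subseteq> T"
      using T unfolding openin_uniform_convergence_topology by blast
    with T M show "\<exists>\<epsilon>>0. {\<Psi> \<in> M. uniform_edist X \<Phi> \<Psi> < ennreal \<epsilon>} \<subseteq> S"
      by (intro exI[of _ e]) auto
  qed (use T in auto)
next
  assume R: ?R
  from bchoice[OF R[THEN conjunct2]] obtain e where
    e: "\<And>\<Phi>. \<Phi> \<in> S \<Longrightarrow> e \<Phi> > 0"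
      "\<And>\<Phi>. \<Phi> \<in> S \<Longrightarrow> {\<Psi> \<in> M. uniform_edist X \<Phi> \<Psi> < ennreal (e \<Phi>)} \<subseteq> S"
    by auto
  \<comment> \<open>The ambient open set cutting out \<open>S\<close>: the union of the full balls,
    with the radii chosen inside \<open>M\<close>.\<close>
  let ?T = "\<Union>\<Phi>\<in>S. {\<Psi> \<in> closed_valued_maps X. uniform_edist X \<Phi> \<Psi> < ennreal (e \<Phi>)}"
  have "openin (uniform_convergence_topology X) ?T"
    using R M by (intro openin_Union) (auto intro: openin_uniform_edist_ball)
  moreover have "S = ?T \<inter> M"
  proof
    show "S \<subseteq> ?T \<inter> M"
    proof
      fix \<Phi> assume "\<Phi> \<in> S"
      moreover from this have "\<Phi> \<in> M" using R by blast
      moreover from this have "\<Phi> \<in> closed_valued_maps X" using M by blast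
      moreover have "uniform_edist X \<Phi> \<Phi> < ennreal (e \<Phi>)"
        using e(1)[OF \<open>\<Phi> \<in> S\<close>] by (simp add: uniform_edist_self)
      ultimately show "\<Phi> \<in> ?T \<inter> M" by blast
    qed
    show "?T \<inter> M \<subseteq> S" using e(2) by auto
  qed
  ultimately show ?L by (auto simp: openin_subtopology)
qed

text \<open>The same radius serves for continuity and for openness. This reduces the theorem to
  bijectivity and preservation of \<open>uniform_edist\<close>.\<close>

lemma isometry_imp_homeomorphic_map:
  assumes MN: "M \<subseteq> closed_valued_maps X" "N \<subseteq> closed_valued_maps X"
    and bij: "bij_betw f M N"
    and iso: "\<And>\<Phi> \<Psi>. \<lbrakk>\<Phi> \<in> M; \<Psi> \<in> M\<rbrakk> \<Longrightarrow> uniform_edist X (f \<Phi>) (f \<Psi>) = uniform_edist X \<Phi> \<Psi>"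
  shows "homeomorphic_map (subtopology (uniform_convergence_topology X) M)
           (subtopology (uniform_convergence_topology X) N) f" (is "homeomorphic_map ?M ?N f")
proof -
  have top: "topspace ?M = M" "topspace ?N = N" using MN by auto
  note op = openin_subtopology_uniform_convergence
  have inj: "inj_on f M" and im: "f ` M = N" using bij by (auto simp: bij_betw_def)
  show ?thesis
  proof (rule bijective_open_imp_homeomorphic_map)
    show "continuous_map ?M ?N f"
      unfolding continuous_map_def top
    proof (intro conjI allI impI)
      show "f \<in> M \<rightarrow> N" using im by auto
      fix U assume U: "openin ?N U"
      show "openin ?M {x \<in> M. f x \<in> U}"
        unfolding op[OF MN(1)]
      proof (intro conjI ballI)
        fix \<Phi> assume \<Phi>: "\<Phi> \<in> {x \<in> M. f x \<in> U}"
        then obtain e where "e > 0" "{\<Psi> \<in> N. uniform_edist X (f \<Phi>) \<Psi> < ennreal e} \<subseteq> U"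
          using U unfolding op[OF MN(2)] by blast
        with \<Phi> im iso show "\<exists>\<epsilon>>0. {\<Psi> \<in> M. uniform_edist X \<Phi> \<Psi> < ennreal \<epsilon>} \<subseteq> {x \<in> M. f x \<in> U}"
          by (intro exI[of _ e]) auto
      qed auto
    qed
    show "open_map ?M ?N f"
      unfolding open_map_def
    proof (intro allI impI)
      fix U assume U: "openin ?M U"
      then have UM: "U \<subseteq> M" unfolding op[OF MN(1)] by blast
      show "openin ?N (f ` U)"
        unfolding op[OF MN(2)]
      proof (intro conjI ballI)
        show "f ` U \<subseteq> N" using UM im by auto
        fix \<Theta> assume "\<Theta> \<in> f ` U"
        then obtain \<Phi> where \<Phi>: "\<Phi> \<in> U" "\<Theta> = f \<Phi>" by blast
        then obtain e where e: "e > 0" "{\<Psi> \<in> M. uniform_edist X \<Phi> \<Psi> < ennreal e} \<subseteq> U"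
          using U unfolding op[OF MN(1)] by blast
        have "{\<Psi> \<in> N. uniform_edist X \<Theta> \<Psi> < ennreal e} \<subseteq> f ` U"
        proof
          fix \<Psi> assume "\<Psi> \<in> {\<Psi> \<in> N. uniform_edist X \<Theta> \<Psi> < ennreal e}"
          then obtain \<Psi>' where \<Psi>': "\<Psi>' \<in> M" "\<Psi> = f \<Psi>'" "uniform_edist X \<Theta> \<Psi> < ennreal e"
            using im by auto
          moreover have "\<Phi> \<in> M" using \<Phi> UM by blast
          ultimately have "uniform_edist X \<Phi> \<Psi>' < ennreal e" using \<Phi> iso by simp
          with \<Psi>' e(2) show "\<Psi> \<in> f ` U" by blast
        qed
        with e(1) show "\<exists>\<epsilon>>0. {\<Psi> \<in> N. uniform_edist X \<Theta> \<Psi> < ennreal \<epsilon>} \<subseteq> f ` U" by blast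
      qed
    qed
  qed (use inj im top in auto)
qed

section \<open>Minimal usco maps\<close>

lemma uscoD:
  fixes F :: "'a \<Rightarrow> 'b::t2_space set"
  assumes "usco X F" "x \<in> topspace X"
  shows "F x \<noteq> {}" "compact (F x)" "closed (F x)"
  using assms by (auto simp: usco_def intro: compact_imp_closed)

lemma upper_semicontinuousE:
  assumes "usco X F" "x \<in> topspace X" "open V" "F x \<subseteq> V"
  obtains U where "openin X U" "x \<in> U" "\<And>u. u \<in> U \<Longrightarrow> F u \<subseteq> V"
  using assms unfolding usco_def upper_semicontinuous_def by meson

lemma usco_extensional_eqI:
  assumes "usco X F" "usco X G" "submap X F G" "submap X G F" shows "F = G"
  using assms unfolding usco_def submap_def by (intro extensionalityI[of _ "topspace X"]) auto

text \<open>Otherwise removing \<open>V\<close> from the values of \<open>F\<close> over \<open>U\<close> would give a smaller usco map.\<close>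

lemma minimal_usco_inside_open:
  fixes F :: "'a \<Rightarrow> 'b::t2_space set"
  assumes F: "minimal_usco X F" and U: "openin X U" "x \<in> U" and V: "open V" "F x \<inter> V \<noteq> {}"
  obtains W where "openin X W" "W \<noteq> {}" "W \<subseteq> U" "\<And>w. w \<in> W \<Longrightarrow> F w \<subseteq> V"
proof -
  have uF: "usco X F" using F by (simp add: minimal_usco_def)
  have "\<exists>u\<in>U. F u \<subseteq> V"
  proof (rule ccontr)
    assume no: "\<not> ?thesis"
    define G where "G = (\<lambda>u. if u \<in> U then F u - V else F u)"
    have "usco X G"
      unfolding usco_def
    proof (intro conjI ballI)
      show "G \<in> extensional (topspace X)"
        using uF openin_subset[OF U(1)] by (auto simp: usco_def extensional_def G_def)
      fix u assume u: "u \<in> topspace X"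
      show "G u \<noteq> {}" using no uscoD(1)[OF uF u] by (auto simp: G_def)
      show "compact (G u)" using uscoD(2)[OF uF u] V by (auto simp: G_def intro: compact_diff)
    next
      show "upper_semicontinuous X G"
        unfolding upper_semicontinuous_def
      proof (intro ballI allI impI)
        fix u O' assume u: "u \<in> topspace X" and O': "open O' \<and> G u \<subseteq> O'"
        show "\<exists>N. openin X N \<and> u \<in> N \<and> (\<forall>w\<in>N. G w \<subseteq> O')"
        proof (cases "u \<in> U")
          case True
          \<comment> \<open>Restoring the removed part costs at most \<open>V\<close>, and over
            \<open>U\<close> that part is removed again, so the neighbourhood is cut down to
            \<open>N \<inter> U\<close>.\<close>
          then have "F u \<subseteq> O' \<union> V" using O' by (auto simp: G_def)
          then obtain N where "openin X N" "u \<in> N" "\<And>w. w \<in> N \<Longrightarrow> F w \<subseteq> O' \<union> V"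
            using upper_semicontinuousE[OF uF u, of "O' \<union> V"] O' V by blast
          then show ?thesis using True U
            by (intro exI[of _ "N \<inter> U"]) (auto simp: G_def)
        next
          case False
          then have "F u \<subseteq> O'" using O' by (auto simp: G_def)
          then obtain N where "openin X N" "u \<in> N" "\<And>w. w \<in> N \<Longrightarrow> F w \<subseteq> O'"
            using upper_semicontinuousE[OF uF u] O' by blast
          then show ?thesis by (intro exI[of _ N]) (auto simp: G_def)
        qed
      qed
    qed
    moreover have "submap X G F" by (auto simp: submap_def G_def)
    ultimately have "G = F" using F by (simp add: minimal_usco_def)
    then have "F x - V = F x" using U(2) by (metis G_def)
    with V(2) show False by blast
  qed
  \<comment> \<open>One point with its value in \<open>V\<close> suffices: upper semicontinuity
    spreads the inclusion to a neighbourhood.\<close>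
  then obtain u where u: "u \<in> U" "F u \<subseteq> V" by blast
  then obtain N where "openin X N" "u \<in> N" "\<And>w. w \<in> N \<Longrightarrow> F w \<subseteq> V"
    using upper_semicontinuousE[OF uF _ V(1)] openin_subset[OF U(1)] by blast
  with u U that[of "N \<inter> U"] show thesis by blast
qed

text \<open>\<open>G n\<close> collects the open sets over which all values of \<open>F\<close>
  share one ball of radius \<open>1/(n+1)\<close>. It is dense by the preceding lemma, so by the
  Baire property the intersection of all \<open>G n\<close> is dense, and there the values have
  diameter 0.\<close>

lemma minimal_usco_single_valued_dense:
  fixes F :: "'a \<Rightarrow> 'b::metric_space set"
  assumes B: "Baire_space X" and F: "minimal_usco X F"
  shows "X closure_of {x \<in> topspace X. \<exists>y. F x = {y}} = topspace X"
proof -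
  have uF: "usco X F" using F by (simp add: minimal_usco_def)
  define G where "G n = \<Union>{W. openin X W \<and> (\<exists>y. \<forall>w\<in>W. F w \<subseteq> ball y (inverse (real (Suc n))))}"
    for n
  have "openin X (G n) \<and> X closure_of (G n) = topspace X" for n
  proof
    show "openin X (G n)" unfolding G_def by (rule openin_Union) auto
    show "X closure_of (G n) = topspace X"
      unfolding dense_intersects_open
    proof (intro allI impI)
      fix U assume U: "openin X U \<and> U \<noteq> {}"
      then obtain x where x: "x \<in> U" "x \<in> topspace X" using openin_subset by blast
      then obtain y where y: "y \<in> F x" using uscoD(1)[OF uF] by blast
      let ?V = "ball y (inverse (real (Suc n)))"
      have "F x \<inter> ?V \<noteq> {}" using y by fastforce
      then obtain W where W: "openin X W" "W \<noteq> {}" "W \<subseteq> U" "\<And>w. w \<in> W \<Longrightarrow> F w \<subseteq> ?V"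
        using minimal_usco_inside_open[OF F _ x(1) open_ball] U by blast
      then have "W \<subseteq> G n" unfolding G_def by blast
      with W show "G n \<inter> U \<noteq> {}" by blast
    qed
  qed
  then have dense: "X closure_of (topspace X \<inter> \<Inter>(range G)) = topspace X"
    using B[unfolded Baire_space_def, rule_format, of "range G"] by auto
  have "topspace X \<inter> \<Inter>(range G) \<subseteq> {x \<in> topspace X. \<exists>y. F x = {y}}"
  proof
    fix x assume x: "x \<in> topspace X \<inter> \<Inter>(range G)"
    then obtain y where y: "y \<in> F x" using uscoD(1)[OF uF] by blast
    have "z = y" if z: "z \<in> F x" for z
    proof (rule ccontr)
      assume "z \<noteq> y"
      then have "dist z y / 2 > 0" by simp
      then obtain n where n: "inverse (real (Suc n)) < dist z y / 2"
        using reals_Archimedean by blast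
      from x have "x \<in> G n" by blast
      then obtain c where "F x \<subseteq> ball c (inverse (real (Suc n)))" unfolding G_def by blast
      \<comment> \<open>Two points closer to \<open>c\<close> than half their mutual distance
        violate the triangle inequality.\<close>
      then have "dist c y < dist z y / 2" "dist c z < dist z y / 2"
        using y z n by (auto simp: subset_iff intro: less_trans)
      then show False using dist_triangle2[of z y c] by (simp add: dist_commute)
    qed
    with x y show "x \<in> {x \<in> topspace X. \<exists>y. F x = {y}}" by auto
  qed
  from closure_of_mono[OF this, of X] show ?thesis
    unfolding dense by (intro subset_antisym closure_of_subset_topspace)
qed

text \<open>The density transfer. If some \<open>y\<close> in \<open>F x\<close> were farther than
  \<open>r\<close> from \<open>G x\<close>, then near \<open>x\<close> the values of
  \<open>G\<close> stay close to \<open>G x\<close>, while on some nonempty open set there the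
  values of \<open>F\<close> stay close to \<open>y\<close>. A point of \<open>D\<close> in that set
  contradicts \<open>near\<close>.\<close>

lemma minimal_usco_near_of_dense:
  fixes F G :: "'a \<Rightarrow> 'b::metric_space set"
  assumes F: "minimal_usco X F" and G: "usco X G"
    and D: "X closure_of D = topspace X"
    and near: "\<And>u. u \<in> D \<Longrightarrow> u \<in> topspace X \<Longrightarrow> \<exists>f\<in>F u. \<exists>g\<in>G u. dist f g \<le> r"
    and x: "x \<in> topspace X"
  shows "F x \<subseteq> (\<Union>z\<in>G x. cball z r)"
proof
  fix y assume y: "y \<in> F x"
  note Gx = uscoD[OF G x]
  show "y \<in> (\<Union>z\<in>G x. cball z r)"
    unfolding infdist_le_iff_compact[OF Gx(2,1), symmetric]
  proof (rule ccontr)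
    assume "\<not> infdist y (G x) \<le> r"
    \<comment> \<open>Half of the surplus over \<open>r\<close>: an error below \<open>d\<close> at
      each end makes the total strictly less than \<open>infdist y (G x)\<close>.\<close>
    define d where "d = (infdist y (G x) - r) / 2"
    have d: "d > 0" using \<open>\<not> infdist y (G x) \<le> r\<close> by (simp add: d_def)
    have "G x \<subseteq> (\<Union>z\<in>G x. ball z d)" using d by auto
    then obtain U where U: "openin X U" "x \<in> U" "\<And>u. u \<in> U \<Longrightarrow> G u \<subseteq> (\<Union>z\<in>G x. ball z d)"
      using upper_semicontinuousE[OF G x, of "\<Union>z\<in>G x. ball z d"] by blast
    have "F x \<inter> ball y d \<noteq> {}" using y d by auto
    then obtain W where W: "openin X W" "W \<noteq> {}" "W \<subseteq> U" "\<And>w. w \<in> W \<Longrightarrow> F w \<subseteq> ball y d"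
      using minimal_usco_inside_open[OF F U(1,2) open_ball] by blast
    then obtain u where u: "u \<in> D" "u \<in> W" using D unfolding dense_intersects_open by blast
    then obtain f g where fg: "f \<in> F u" "g \<in> G u" "dist f g \<le> r"
      using near openin_subset[OF W(1)] by blast
    then obtain z where z: "z \<in> G x" "dist z g < d" using U(3)[of u] u W(3) by force
    have "dist y f < d" using W(4)[of u] u fg by auto
    have "infdist y (G x) \<le> dist y z" using z by (rule_tac infdist_le)
    also have "\<dots> \<le> dist y f + dist f g + dist g z"
      using dist_triangle[of y z g] dist_triangle[of y g f] by linarith
    also have "\<dots> < d + r + d" using \<open>dist y f < d\<close> fg z by (simp add: dist_commute)
    finally show False by (simp add: d_def)
  qed
qed

section \<open>Existence of minimal usco maps\<close>

text \<open>All rests on \<open>inside\<close>: if the intersection at \<open>x\<close> lies in an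
  open \<open>V\<close>, compactness puts a single member of the chain there already. Upper
  semicontinuity is then inherited from that member.\<close>

lemma usco_Inter_chain:
  fixes C :: "('a \<Rightarrow> 'b::t2_space set) set"
  assumes C: "C \<noteq> {}" "\<And>F. F \<in> C \<Longrightarrow> usco X F"
    and chain: "\<And>F G. F \<in> C \<Longrightarrow> G \<in> C \<Longrightarrow> submap X F G \<or> submap X G F"
  shows "usco X (\<lambda>x\<in>topspace X. \<Inter>F\<in>C. F x)"
proof -
  from C obtain F0 where F0: "F0 \<in> C" by blast
  have least: "\<exists>F\<in>I. \<forall>G\<in>I. submap X F G" if "finite I" "I \<noteq> {}" "I \<subseteq> C" for I
    using that
  proof (induction I rule: finite_ne_induct)
    case (singleton F) then show ?case by (simp add: submap_def)
  next
    case (insert F I)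
    then obtain H where H: "H \<in> I" "\<forall>G\<in>I. submap X H G" by auto
    from insert H chain have "submap X F H \<or> submap X H F" by blast
    then show ?case
    proof
      assume "submap X F H"
      with H show ?thesis by (intro bexI[of _ F]) (fastforce simp: submap_def)+
    qed (use H in \<open>auto intro!: bexI[of _ H]\<close>)
  qed
  have inside: "\<exists>F\<in>C. F x \<subseteq> V" if x: "x \<in> topspace X" and V: "open V" "(\<Inter>F\<in>C. F x) \<subseteq> V" for x V
  proof (rule ccontr)
    assume no: "\<not> ?thesis"
    \<comment> \<open>Finite intersection property in the compact set \<open>F0 x - V\<close>:
      finitely many members together with \<open>F0\<close> have a least one \<open>H\<close>, and
      \<open>H x\<close> has a point outside \<open>V\<close>.\<close>
    have "(F0 x - V) \<inter> (\<Inter>F\<in>C. F x) \<noteq> {}"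
    proof (rule compact_imp_fip_image)
      show "compact (F0 x - V)" using uscoD(2)[OF C(2)[OF F0] x] V by (auto intro: compact_diff)
      show "closed (F x)" if "F \<in> C" for F using uscoD(3)[OF C(2)[OF that] x] .
      fix I assume I: "finite I" "I \<subseteq> C"
      then obtain H where H: "H \<in> C" "\<forall>G\<in>insert F0 I. submap X H G"
        using least[of "insert F0 I"] F0 by auto
      obtain y where "y \<in> H x" "y \<notin> V" using no H(1) by blast
      with H(2) x have "y \<in> (F0 x - V) \<inter> (\<Inter>F\<in>I. F x)" by (fastforce simp: submap_def)
      then show "(F0 x - V) \<inter> (\<Inter>F\<in>I. F x) \<noteq> {}" by blast
    qed
    with V show False by blast
  qed
  show ?thesis
    unfolding usco_def
  proof (intro conjI ballI)
    fix x assume x: "x \<in> topspace X"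
    show "(\<lambda>x\<in>topspace X. \<Inter>F\<in>C. F x) x \<noteq> {}"
    proof
      assume "(\<lambda>x\<in>topspace X. \<Inter>F\<in>C. F x) x = {}"
      \<comment> \<open>With \<open>V\<close> empty, \<open>inside\<close> would give a member with
        an empty value.\<close>
      with inside[OF x, of "{}"] x obtain F where F: "F \<in> C" "F x = {}" by auto
      with uscoD(1)[OF C(2)[OF F(1)] x] show False by simp
    qed
    have "closed (\<Inter>F\<in>C. F x)" by (intro closed_INT ballI uscoD(3)[OF C(2) x])
    then have "compact (F0 x \<inter> (\<Inter>F\<in>C. F x))"
      using uscoD(2)[OF C(2)[OF F0] x] by (rule_tac compact_Int_closed)
    moreover have "F0 x \<inter> (\<Inter>F\<in>C. F x) = (\<Inter>F\<in>C. F x)" using F0 by blast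
    ultimately show "compact ((\<lambda>x\<in>topspace X. \<Inter>F\<in>C. F x) x)" using x by simp
  next
    show "upper_semicontinuous X (\<lambda>x\<in>topspace X. \<Inter>F\<in>C. F x)"
      unfolding upper_semicontinuous_def
    proof (intro ballI allI impI)
      fix x V assume x: "x \<in> topspace X"
        and V: "open V \<and> (\<lambda>x\<in>topspace X. \<Inter>F\<in>C. F x) x \<subseteq> V"
      then obtain F where F: "F \<in> C" "F x \<subseteq> V" using inside[OF x, of V] by auto
      then obtain U where U: "openin X U" "x \<in> U" "\<And>u. u \<in> U \<Longrightarrow> F u \<subseteq> V"
        using upper_semicontinuousE[OF C(2)[OF F(1)] x] V by blast
      have "(\<lambda>x\<in>topspace X. \<Inter>F\<in>C. F x) u \<subseteq> V" if u: "u \<in> U" for u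
        using F(1) U(3)[OF u] subsetD[OF openin_subset[OF U(1)] u] by auto
      with U show "\<exists>U. openin X U \<and> x \<in> U \<and> (\<forall>u\<in>U. (\<lambda>x\<in>topspace X. \<Inter>F\<in>C. F x) u \<subseteq> V)"
        by blast
    qed
  qed auto
qed

theorem usco_contains_minimal_usco:
  fixes \<Phi> :: "'a \<Rightarrow> 'b::t2_space set"
  assumes \<Phi>: "usco X \<Phi>"
  obtains F where "minimal_usco X F" "submap X F \<Phi>"
proof -
  let ?A = "{F. usco X F \<and> submap X F \<Phi>}"
  \<comment> \<open>Inclusion is reversed, so that the maximal elements of Zorn's lemma are minimal
    maps.\<close>
  let ?P = "\<lambda>F G. submap X G F"
  have "\<exists>F\<in>?A. \<forall>G\<in>?A. ?P F G \<longrightarrow> G = F"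
  proof (rule predicate_Zorn)
    show "partial_order_on ?A (relation_of ?P ?A)"
      by (rule partial_order_on_relation_ofI)
        (auto simp: submap_def[abs_def] intro: usco_extensional_eqI[unfolded submap_def])
    fix C assume CC: "C \<in> Chains (relation_of ?P ?A)"
    then have CA: "C \<subseteq> ?A" by (rule Chains_relation_of)
    show "\<exists>H\<in>?A. \<forall>F\<in>C. ?P F H"
    proof (cases "C = {}")
      case True
      \<comment> \<open>The empty chain is bounded by \<open>\<Phi>\<close> itself; its pointwise
        intersection would be \<open>UNIV\<close>.\<close>
      with \<Phi> show ?thesis by (intro bexI[of _ \<Phi>]) (auto simp: submap_def)
    next
      case False
      let ?H = "\<lambda>x\<in>topspace X. \<Inter>F\<in>C. F x"
      have "usco X ?H"
        using False CA CC by (intro usco_Inter_chain) (auto simp: Chains_def relation_of_def)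
      moreover have sub: "submap X ?H F" if "F \<in> C" for F
        using that by (auto simp: submap_def)
      moreover have "submap X ?H \<Phi>"
      proof -
        from False obtain F where "F \<in> C" by blast
        with CA sub[of F] show ?thesis by (fastforce simp: submap_def)
      qed
      ultimately show ?thesis by blast
    qed
  qed
  then obtain F where F: "usco X F" "submap X F \<Phi>"
    "\<And>G. usco X G \<Longrightarrow> submap X G \<Phi> \<Longrightarrow> submap X G F \<Longrightarrow> G = F" by blast
  have "minimal_usco X F"
    unfolding minimal_usco_def
  proof (intro conjI allI impI)
    fix G assume G: "usco X G \<and> submap X G F"
    \<comment> \<open>Minimality below \<open>\<Phi>\<close> is minimality outright, since whatever
      lies in \<open>F\<close> lies in \<open>\<Phi>\<close>.\<close>
    with F(2) have "submap X G \<Phi>" unfolding submap_def by blast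
    with F(3) G show "G = F" by blast
  qed (rule F(1))
  with F(2) that show thesis by blast
qed

section \<open>The closed convex hull map\<close>

lemma closed_convex_hull_map_apply:
  "x \<in> topspace X \<Longrightarrow> closed_convex_hull_map X F x = closure (convex hull (F x))"
  by (simp add: closed_convex_hull_map_def)

text \<open>For upper semicontinuity, the compact hull \<open>?K\<close> has a closed
  \<open>e\<close>-neighbourhood inside \<open>V\<close>. Being closed and convex, it contains the
  hull of \<open>F u\<close> as soon as it contains \<open>F u\<close>.\<close>

lemma cusco_closed_convex_hull_map:
  fixes F :: "'a \<Rightarrow> 'b::banach set"
  assumes F: "usco X F"
  shows "cusco X (closed_convex_hull_map X F)"
  unfolding cusco_def usco_def
proof (intro conjI ballI)
  show "closed_convex_hull_map X F \<in> extensional (topspace X)"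
    by (simp add: closed_convex_hull_map_def)
  fix x assume x: "x \<in> topspace X"
  note Fx = uscoD[OF F x]
  show "closed_convex_hull_map X F x \<noteq> {}" "convex (closed_convex_hull_map X F x)"
    using Fx by (auto simp: closed_convex_hull_map_apply[OF x] intro: convex_closure)
  show "compact (closed_convex_hull_map X F x)"
    using compact_closure_convex_hull[OF Fx(2)] by (simp add: closed_convex_hull_map_apply[OF x])
next
  show "upper_semicontinuous X (closed_convex_hull_map X F)"
    unfolding upper_semicontinuous_def
  proof (intro ballI allI impI)
    fix x V assume x: "x \<in> topspace X" and V: "open V \<and> closed_convex_hull_map X F x \<subseteq> V"
    let ?K = "closure (convex hull (F x))"
    have K: "compact ?K" by (rule compact_closure_convex_hull[OF uscoD(2)[OF F x]])
    have "?K \<subseteq> V" using V by (simp add: closed_convex_hull_map_apply[OF x])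
    then obtain e where e: "e > 0" "(\<Union>z\<in>?K. cball z e) \<subseteq> V"
      using compact_subset_open_imp_cball_epsilon_subset[OF K] V by blast
    \<comment> \<open>Open balls make \<open>?N\<close> open, as upper semicontinuity of
      \<open>F\<close> requires; closed balls return when the hull is taken.\<close>
    let ?N = "\<Union>z\<in>?K. ball z e"
    have "F x \<subseteq> ?N" using subset_closure_convex_hull[of "F x"] e(1) by fastforce
    then obtain U where U: "openin X U" "x \<in> U" "\<And>u. u \<in> U \<Longrightarrow> F u \<subseteq> ?N"
      using upper_semicontinuousE[OF F x, of ?N] by blast
    have "closed_convex_hull_map X F u \<subseteq> V" if u: "u \<in> U" for u
    proof -
      have "F u \<subseteq> (\<Union>z\<in>?K. cball z e)"
        by (rule order_trans[OF U(3)[OF u] UN_mono[OF order_refl ball_subset_cball]])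
      then have "closure (convex hull (F u)) \<subseteq> (\<Union>z\<in>?K. cball z e)"
        by (rule closure_convex_hull_minimal[OF _ closed_UN_cball[OF K]
              convex_UN_cball[OF convex_closure[OF convex_convex_hull]]])
      moreover have "u \<in> topspace X" using u openin_subset[OF U(1)] by blast
      ultimately show ?thesis using e(2) by (simp add: closed_convex_hull_map_apply)
    qed
    with U show "\<exists>U. openin X U \<and> x \<in> U \<and> (\<forall>u\<in>U. closed_convex_hull_map X F u \<subseteq> V)" by blast
  qed
qed

text \<open>Where \<open>F u\<close> is a singleton, so is its hull, and the nonempty
  \<open>\<Psi> u\<close> inside must equal it. The density transfer with radius 0 then gives
  \<open>F x \<subseteq> \<Psi> x\<close> everywhere, and \<open>\<Psi> x\<close>, closed and
  convex, contains the hull.\<close>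

lemma minimal_cusco_closed_convex_hull_map:
  fixes F :: "'a \<Rightarrow> 'b::banach set"
  assumes B: "Baire_space X" and F: "minimal_usco X F"
  shows "minimal_cusco X (closed_convex_hull_map X F)"
  unfolding minimal_cusco_def
proof (intro conjI allI impI)
  have uF: "usco X F" using F by (simp add: minimal_usco_def)
  then show cF: "cusco X (closed_convex_hull_map X F)" by (rule cusco_closed_convex_hull_map)
  fix \<Psi> assume "cusco X \<Psi> \<and> submap X \<Psi> (closed_convex_hull_map X F)"
  then have \<Psi>: "cusco X \<Psi>" "usco X \<Psi>" "submap X \<Psi> (closed_convex_hull_map X F)"
    by (auto simp: cusco_def)
  have "F x \<subseteq> \<Psi> x" if x: "x \<in> topspace X" for x
  proof -
    have "F x \<subseteq> (\<Union>z\<in>\<Psi> x. cball z 0)"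
    proof (rule minimal_usco_near_of_dense[OF F \<Psi>(2) minimal_usco_single_valued_dense[OF B F] _ x])
      fix u assume u: "u \<in> {x \<in> topspace X. \<exists>y. F x = {y}}"
      then obtain y where y: "u \<in> topspace X" "F u = {y}" by blast
      then have "closed_convex_hull_map X F u = {y}" by (simp add: closed_convex_hull_map_apply)
      then have "\<Psi> u \<subseteq> {y}" using \<Psi>(3) y(1) by (auto simp: submap_def)
      moreover have "\<Psi> u \<noteq> {}" using uscoD(1)[OF \<Psi>(2) y(1)] .
      ultimately show "\<exists>f\<in>F u. \<exists>g\<in>\<Psi> u. dist f g \<le> 0" using y by auto
    qed
    then show ?thesis by (simp only: cball_trivial UN_singleton)
  qed
  then have "closure (convex hull (F x)) \<subseteq> \<Psi> x" if "x \<in> topspace X" for x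
    using that \<Psi>(1) uscoD(3)[OF \<Psi>(2) that]
    by (intro closure_convex_hull_minimal) (auto simp only: cusco_def)
  then have "submap X (closed_convex_hull_map X F) \<Psi>"
    by (simp add: submap_def closed_convex_hull_map_apply)
  with \<Psi> cF show "\<Psi> = closed_convex_hull_map X F"
    by (intro usco_extensional_eqI) (auto simp: cusco_def)
qed

lemma minimal_cusco_is_hull_of_minimal_usco:
  fixes \<Phi> :: "'a \<Rightarrow> 'b::banach set"
  assumes \<Phi>: "minimal_cusco X \<Phi>"
  obtains F where "minimal_usco X F" "closed_convex_hull_map X F = \<Phi>"
proof -
  have c: "cusco X \<Phi>" and u: "usco X \<Phi>" using \<Phi> by (auto simp: minimal_cusco_def cusco_def)
  obtain F where F: "minimal_usco X F" "submap X F \<Phi>" using usco_contains_minimal_usco[OF u] .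
  have "closure (convex hull (F x)) \<subseteq> \<Phi> x" if "x \<in> topspace X" for x
    using F(2) c uscoD(3)[OF u that] that
    by (intro closure_convex_hull_minimal) (auto simp: submap_def cusco_def)
  then have "submap X (closed_convex_hull_map X F) \<Phi>"
    by (simp add: submap_def closed_convex_hull_map_apply)
  moreover have "cusco X (closed_convex_hull_map X F)"
    using F by (intro cusco_closed_convex_hull_map) (simp add: minimal_usco_def)
  ultimately have "closed_convex_hull_map X F = \<Phi>" using \<Phi> by (simp add: minimal_cusco_def)
  with F that show thesis by blast
qed

section \<open>The hull map as an isometry\<close>

text \<open>For finite excess \<open>r\<close>, the closed \<open>r\<close>-neighbourhood of the
  hull of \<open>B\<close> is closed and convex and contains \<open>A\<close>, hence also the hull
  of \<open>A\<close>.\<close>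

lemma excess_closure_convex_hull_le:
  fixes A B :: "'b::banach set"
  assumes B: "compact B" "B \<noteq> {}"
  shows "excess (closure (convex hull A)) (closure (convex hull B)) \<le> excess A B"
proof (cases "excess A B")
  case (real r)
  let ?K = "closure (convex hull B)"
  have K: "compact ?K" "?K \<noteq> {}"
    by (rule compact_closure_convex_hull[OF B(1)]) (simp add: B(2))
  have "A \<subseteq> (\<Union>x\<in>B. cball x r)"
    using eq_refl[OF real(2)] unfolding excess_le_iff[OF B real(1)] .
  then have "A \<subseteq> (\<Union>x\<in>?K. cball x r)"
    by (rule order_trans[OF _ UN_mono[OF subset_closure_convex_hull order_refl]])
  then have "closure (convex hull A) \<subseteq> (\<Union>x\<in>?K. cball x r)"
    by (rule closure_convex_hull_minimal[OF _ closed_UN_cball[OF K(1)]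
          convex_UN_cball[OF convex_closure[OF convex_convex_hull]]])
  then show ?thesis unfolding real(2) excess_le_iff[OF K real(1)] .
qed simp

text \<open>The direction flips: the hypothesis bounds the excess of the hull of \<open>G u\<close>
  over that of \<open>F u\<close>, the conclusion that of \<open>F x\<close> over
  \<open>G x\<close>. Where \<open>F u\<close> is a singleton, any \<open>g\<close> in
  \<open>G u\<close> is within \<open>r\<close> of its point, which is all the density transfer asks
  for.\<close>

lemma minimal_usco_excess_le:
  fixes F G :: "'a \<Rightarrow> 'b::banach set"
  assumes B: "Baire_space X" and F: "minimal_usco X F" and G: "usco X G" and r: "r \<ge> 0"
    and le: "\<And>u. u \<in> topspace X \<Longrightarrow>
      excess (closure (convex hull (G u))) (closure (convex hull (F u))) \<le> ennreal r"
    and x: "x \<in> topspace X"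
  shows "excess (F x) (G x) \<le> ennreal r"
proof -
  have "F x \<subseteq> (\<Union>z\<in>G x. cball z r)"
  proof (rule minimal_usco_near_of_dense[OF F G minimal_usco_single_valued_dense[OF B F] _ x])
    fix u assume u: "u \<in> {x \<in> topspace X. \<exists>y. F x = {y}}"
    then obtain y where y: "u \<in> topspace X" "F u = {y}" by blast
    then obtain g where g: "g \<in> G u" using uscoD(1)[OF G] by blast
    have "closure (convex hull (G u)) \<subseteq> cball y r"
      using le[OF y(1)] y(2) r by (simp add: excess_le_iff)
    with g have "dist y g \<le> r" using subset_closure_convex_hull[of "G u"] by auto
    with y g show "\<exists>f\<in>F u. \<exists>g\<in>G u. dist f g \<le> r" by auto
  qed
  then show ?thesis using excess_le_iff[OF uscoD(2,1)[OF G x] r] by simp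
qed

lemma uniform_edist_closed_convex_hull_map:
  fixes F G :: "'a \<Rightarrow> 'b::banach set"
  assumes B: "Baire_space X" and F: "minimal_usco X F" and G: "minimal_usco X G"
  shows "uniform_edist X (closed_convex_hull_map X F) (closed_convex_hull_map X G)
       = uniform_edist X F G" (is "?h = ?d")
proof (rule antisym)
  have uF: "usco X F" and uG: "usco X G" using F G by (auto simp: minimal_usco_def)
  show "?h \<le> ?d"
    unfolding uniform_edist_def
  proof (rule SUP_mono)
    fix x assume x: "x \<in> topspace X"
    have "Hausdorff_edist (closed_convex_hull_map X F x) (closed_convex_hull_map X G x)
        \<le> Hausdorff_edist (F x) (G x)"
      unfolding Hausdorff_edist_def closed_convex_hull_map_apply[OF x]
      by (intro max.mono excess_closure_convex_hull_le uscoD[OF uF x] uscoD[OF uG x])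
    with x show "\<exists>z\<in>topspace X. Hausdorff_edist (closed_convex_hull_map X F x)
        (closed_convex_hull_map X G x) \<le> Hausdorff_edist (F z) (G z)" by blast
  qed
  show "?d \<le> ?h"
  proof (cases ?h)
    case (real r)
    have le: "excess (closure (convex hull (F u))) (closure (convex hull (G u))) \<le> ennreal r"
        "excess (closure (convex hull (G u))) (closure (convex hull (F u))) \<le> ennreal r"
      if u: "u \<in> topspace X" for u
    proof -
      have "Hausdorff_edist (closed_convex_hull_map X F u) (closed_convex_hull_map X G u)
          \<le> ennreal r"
        unfolding real(2)[symmetric] uniform_edist_def by (rule SUP_upper[OF u])
      then show "excess (closure (convex hull (F u))) (closure (convex hull (G u))) \<le> ennreal r"
        "excess (closure (convex hull (G u))) (closure (convex hull (F u))) \<le> ennreal r"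
        by (auto simp: Hausdorff_edist_def closed_convex_hull_map_apply[OF u])
    qed
    \<comment> \<open>Because of the flip, each excess between \<open>F\<close> and \<open>G\<close>
      comes from the opposite excess between the hulls.\<close>
    show ?thesis
      unfolding real(2) unfolding uniform_edist_def Hausdorff_edist_def
      by (intro SUP_least max.boundedI minimal_usco_excess_le[OF B F uG real(1) le(2)]
          minimal_usco_excess_le[OF B G uF real(1) le(1)])
  qed simp
qed

text \<open>Compact values turn excess 0 into inclusion, as balls of radius 0 are points. This makes
  the isometry injective.\<close>

lemma usco_eq_if_uniform_edist_zero:
  assumes F: "usco X F" and G: "usco X G" and z: "uniform_edist X F G = 0"
  shows "F = G"
proof -
  have "F x \<subseteq> G x \<and> G x \<subseteq> F x" if x: "x \<in> topspace X" for x
  proof -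
    have "Hausdorff_edist (F x) (G x) \<le> ennreal 0"
      using SUP_upper[OF x, of "\<lambda>x. Hausdorff_edist (F x) (G x)"] z
      by (simp add: uniform_edist_def)
    then have "excess (F x) (G x) \<le> ennreal 0" "excess (G x) (F x) \<le> ennreal 0"
      unfolding Hausdorff_edist_def max.bounded_iff by blast+
    then show ?thesis
      unfolding excess_le_iff[OF uscoD(2,1)[OF G x] order_refl]
        excess_le_iff[OF uscoD(2,1)[OF F x] order_refl] by simp
  qed
  then show ?thesis by (intro usco_extensional_eqI[OF F G]) (auto simp: submap_def)
qed

theorem theorem3p3:
  fixes X :: "'a topology"
  assumes "Hausdorff_space X" and "Baire_space X"
  shows "homeomorphic_map
           (MU_topology X :: ('a \<Rightarrow> 'b::banach set) topology)
           (MC_topology X :: ('a \<Rightarrow> 'b set) topology)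
           (closed_convex_hull_map X)"
  unfolding MU_topology_def MC_topology_def
proof (rule isometry_imp_homeomorphic_map)
  let ?\<phi> = "closed_convex_hull_map X :: ('a \<Rightarrow> 'b set) \<Rightarrow> _"
  show "(MU X :: ('a \<Rightarrow> 'b set) set) \<subseteq> closed_valued_maps X"
    by (auto simp: MU_def minimal_usco_def intro: usco_in_closed_valued_maps)
  show "(MC X :: ('a \<Rightarrow> 'b set) set) \<subseteq> closed_valued_maps X"
    by (auto simp: MC_def minimal_cusco_def cusco_def intro: usco_in_closed_valued_maps)
  show iso: "uniform_edist X (?\<phi> F) (?\<phi> G) = uniform_edist X F G"
    if "F \<in> MU X" "G \<in> MU X" for F G
    using that uniform_edist_closed_convex_hull_map[OF assms(2)] by (simp add: MU_def)
  show "bij_betw ?\<phi> (MU X) (MC X)"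
    unfolding bij_betw_def
  proof
    show "inj_on ?\<phi> (MU X)"
    proof (rule inj_onI)
      fix F G assume FG: "F \<in> MU X" "G \<in> MU X" "?\<phi> F = ?\<phi> G"
      then have "uniform_edist X F G = 0" using iso[OF FG(1,2)] by (simp add: uniform_edist_self)
      with FG show "F = G"
        by (auto simp: MU_def minimal_usco_def intro: usco_eq_if_uniform_edist_zero)
    qed
    show "?\<phi> ` MU X = MC X"
      \<comment> \<open>One inclusion is minimality of the hull; the other presents each minimal
        cusco map as the hull of a minimal usco map.\<close>
      using minimal_cusco_closed_convex_hull_map[OF assms(2)]
      by (auto simp: MU_def MC_def elim!: minimal_cusco_is_hull_of_minimal_usco)
  qed
qed

end
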